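(* Let $q$ be a prime power, let $m\ge 1$, $n\ge 2$ be integers, let $h$ be an integer with $1\le h\le m$, and let $X$ be a vector space of dimension $n$ over $\mathbb{F}_{q^m}$, regarded as an $mn$-dimensional vector space over $\mathbb{F}_q$. There exists a partial Desarguesian $m$-spread $\mathcal{A}$ of $X$ of size $|\mathcal{A}|=q^{m(n-1)}$ for which there exists an $(\mathcal{A},h)$-evasive $\mathbb{F}_q$-subspace of $X$ of dimension $m(n-1)+h$ over $\mathbb{F}_q$.
   Context: A collection $\mathcal{A}$ of $m$-dimensional $\mathbb{F}_q$-subspaces of $X$ is a partial $m$-spread if $S\cap S'=\{0\}$ for all distinct $S,S'\in\mathcal{A}$; it is an $m$-spread if moreover every non-zero vector of $X$ lies in exactly one element of $\mathcal{A}$. Let $\mathcal{D}=\{\langle x\rangle_{\mathbb{F}_{q^m}} : x\in X\setminus\{0\}\}$, which is an $m$-spread of $X$. An $m$-spread of $X$ is Desarguesian if it is the image of $\mathcal{D}$ under an invertible $\mathbb{F}_q$-semilinear map of $X$ (an element of $\Gamma\mathrm{L}(nm,q)$); a partial $m$-spread is called partial Desarguesian if it is contained in a Desarguesian $m$-spread. An $\mathbb{F}_q$-subspace $U\le X$ is $(\mathcal{A},h)$-evasive if $\dim_{\mathbb{F}_q}(U\cap S)\leq h$ for all $S\in\mathcal{A}$. *)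

theory Defs
  imports "HOL-Number_Theory.Prime_Powers" "HOL-Library.Cardinality"
begin

text \<open>
  The field extension of degree \<open>m\<close> is given by two field types \<open>'f\<close>, \<open>'k\<close> and a field homomorphism
  \<open>e :: 'f \<Rightarrow> 'k\<close>. A vector space over \<open>'k\<close> is given by its scalar multiplication on a type \<open>'v\<close>
  (locale \<^locale>\<open>vector_space\<close>), and it becomes a vector space over \<open>'f\<close> by restriction of scalars
  along \<open>e\<close>.
\<close>

definition field_homomorphism :: "('a::field \<Rightarrow> 'b::field) \<Rightarrow> bool" where
  "field_homomorphism e \<longleftrightarrow>
     e 1 = 1 \<and> (\<forall>a b. e (a + b) = e a + e b) \<and> (\<forall>a b. e (a * b) = e a * e b)"

definition restrict_scalars ::
    "('f::field \<Rightarrow> 'k::field) \<Rightarrow> ('k \<Rightarrow> 'v::ab_group_add \<Rightarrow> 'v) \<Rightarrow> 'f \<Rightarrow> 'v \<Rightarrow> 'v" where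
  "restrict_scalars e scale = (\<lambda>a. scale (e a))"

lemma vector_space_restrict_scalars:
  assumes "field_homomorphism e" "vector_space scale"
  shows "vector_space (restrict_scalars e scale)"
proof -
  interpret vector_space scale by (rule assms(2))
  show ?thesis
    using assms(1)
    by unfold_locales
       (simp_all add: field_homomorphism_def restrict_scalars_def scale_right_distrib scale_left_distrib)
qed

definition partial_spread ::
    "('f::field \<Rightarrow> 'v::ab_group_add \<Rightarrow> 'v) \<Rightarrow> nat \<Rightarrow> 'v set set \<Rightarrow> bool" where
  "partial_spread s m A \<longleftrightarrow>
     (\<forall>S\<in>A. module.subspace s S \<and> vector_space.dim s S = m) \<and>
     (\<forall>S\<in>A. \<forall>S'\<in>A. S \<noteq> S' \<longrightarrow> S \<inter> S' = {0})"

definition spread ::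
    "('f::field \<Rightarrow> 'v::ab_group_add \<Rightarrow> 'v) \<Rightarrow> nat \<Rightarrow> 'v set set \<Rightarrow> bool" where
  "spread s m A \<longleftrightarrow> partial_spread s m A \<and> (\<forall>x. x \<noteq> 0 \<longrightarrow> (\<exists>!S. S \<in> A \<and> x \<in> S))"

definition semilinear_map ::
    "('f::field \<Rightarrow> 'v::ab_group_add \<Rightarrow> 'v) \<Rightarrow> ('v \<Rightarrow> 'v) \<Rightarrow> bool" where
  "semilinear_map s f \<longleftrightarrow>
     (\<forall>x y. f (x + y) = f x + f y) \<and>
     (\<exists>\<sigma>. field_homomorphism \<sigma> \<and> bij \<sigma> \<and> (\<forall>a x. f (s a x) = s (\<sigma> a) (f x)))"

definition line_spread :: "('k::field \<Rightarrow> 'v::ab_group_add \<Rightarrow> 'v) \<Rightarrow> 'v set set" where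
  "line_spread scale = {module.span scale {x} | x. x \<noteq> 0}"

definition desarguesian_spread ::
    "('f::field \<Rightarrow> 'k::field) \<Rightarrow> ('k \<Rightarrow> 'v::ab_group_add \<Rightarrow> 'v) \<Rightarrow> nat \<Rightarrow> 'v set set \<Rightarrow> bool" where
  "desarguesian_spread e scale m B \<longleftrightarrow>
     spread (restrict_scalars e scale) m B \<and>
     (\<exists>f. semilinear_map (restrict_scalars e scale) f \<and> bij f \<and> B = (\<lambda>S. f ` S) ` line_spread scale)"

definition partial_desarguesian_spread ::
    "('f::field \<Rightarrow> 'k::field) \<Rightarrow> ('k \<Rightarrow> 'v::ab_group_add \<Rightarrow> 'v) \<Rightarrow> nat \<Rightarrow> 'v set set \<Rightarrow> bool" where
  "partial_desarguesian_spread e scale m A \<longleftrightarrow>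
     partial_spread (restrict_scalars e scale) m A \<and> (\<exists>B. desarguesian_spread e scale m B \<and> A \<subseteq> B)"

definition evasive ::
    "('f::field \<Rightarrow> 'v::ab_group_add \<Rightarrow> 'v) \<Rightarrow> 'v set set \<Rightarrow> nat \<Rightarrow> 'v set \<Rightarrow> bool" where
  "evasive s A h U \<longleftrightarrow> module.subspace s U \<and> (\<forall>S\<in>A. vector_space.dim s (U \<inter> S) \<le> h)"

end

theory Submission
  imports Defs
begin

text \<open>
  Fix a \<open>K\<close>-hyperplane \<open>H\<close> of \<open>X\<close> and a vector \<open>v \<notin> H\<close>, and let \<open>\<A>\<close> consist of the \<open>K\<close>-lines
  \<open>\<langle>v + y\<rangle>\<close> with \<open>y \<in> H\<close>, i.e. of the lines not contained in \<open>H\<close>.  For an \<open>h\<close>-dimensional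
  \<open>F\<close>-subspace \<open>W\<close> of \<open>K\<close>, the \<open>F\<close>-space \<open>U = H \<oplus> W v\<close> meets \<open>\<langle>v + y\<rangle>\<close> exactly in
  \<open>W (v + y)\<close>.  Since everything is finite, dimensions over \<open>F\<close> are computed by counting.
\<close>

text \<open>Each new basis vector \<open>a\<close> multiplies the size of the span by
  \<open>CARD('a)\<close>: the map \<open>(c, y)\<close> to \<open>c *s a + y\<close> is onto by the
  description of \<open>span (insert a B)\<close> and injective because \<open>a\<close> is outside
  \<open>span B\<close>.\<close>

lemma (in vector_space) finite_span_card_span:
  assumes fin: "finite (UNIV :: 'a set)" and "finite B" "independent B"
  shows "finite (span B) \<and> card (span B) = CARD('a) ^ card B"
  using assms(2,3)
proof (induction B rule: finite_induct)
  case empty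
  then show ?case by simp
next
  case (insert a B)
  have ind: "independent B" and a: "a \<notin> span B"
    using insert.prems insert.hyps by (auto simp: independent_insert)
  let ?g = "\<lambda>(c, y). c *s a + y"
  have "inj_on ?g (UNIV \<times> span B)"
  proof (rule inj_onI, clarify)
    fix c d x y assume xy: "x \<in> span B" "y \<in> span B" and eq: "c *s a + x = d *s a + y"
    have "(c - d) *s a = y - x"
      using eq by (simp add: scale_left_diff_distrib algebra_simps)
    then have "(c - d) *s a \<in> span B"
      using xy span_diff by metis
    then have "c = d"
      using a span_scale[of "(c - d) *s a" B "inverse (c - d)"] by (cases "c = d") simp_all
    then show "c = d \<and> x = y" using eq by simp
  qed
  moreover have "?g ` (UNIV \<times> span B) = span (insert a B)"
  proof (intro equalityI subsetI)
    fix z assume "z \<in> span (insert a B)"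
    then obtain c where "z - c *s a \<in> span B"
      by (auto simp: span_insert)
    then show "z \<in> ?g ` (UNIV \<times> span B)"
      by (intro image_eqI[of _ _ "(c, z - c *s a)"]) auto
  next
    fix z assume "z \<in> ?g ` (UNIV \<times> span B)"
    then obtain c y where "z = c *s a + y" "y \<in> span B" by auto
    then show "z \<in> span (insert a B)"
      by (auto simp: span_insert intro!: exI[of _ c])
  qed
  ultimately have "bij_betw ?g (UNIV \<times> span B) (span (insert a B))"
    by (simp add: bij_betw_def)
  with insert ind fin show ?case
    by (metis bij_betw_finite bij_betw_same_card card_cartesian_product card_insert_disjoint
        finite_cartesian_product power_Suc)
qed

lemma (in vector_space) card_subspace:
  assumes fin: "finite (UNIV :: 'a set)" and "finite S" "subspace S"
  shows "card S = CARD('a) ^ dim S"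
proof -
  obtain B where B: "B \<subseteq> S" "independent B" "S \<subseteq> span B" "card B = dim S"
    using basis_exists by blast
  then have "span B = S"
    using assms(3) span_minimal by blast
  then show ?thesis
    using finite_span_card_span[OF fin _ B(2)] B assms(2) finite_subset by metis
qed

text \<open>A field contains both 0 and 1, so its order exceeds 1 and the exponent of a power of it
  is determined. Dimensions over the small field can thus be read off from cardinalities computed
  over the large one.\<close>

lemma (in vector_space) dim_eqI_card:
  assumes fin: "finite (UNIV :: 'a set)" and "finite S" "subspace S" "card S = CARD('a) ^ d"
  shows "dim S = d"
proof -
  have "card {0, 1 :: 'a} \<le> CARD('a)"
    using fin by (intro card_mono) auto
  then have "CARD('a) > 1" by simp
  then show ?thesis
    using card_subspace[OF assms(1-3)] assms(4) power_inject_exp by metis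
qed

lemma (in vector_space) subspace_of_dim_exists:
  assumes "d \<le> dim UNIV"
  shows "\<exists>W. subspace W \<and> dim W = d"
proof -
  obtain B where B: "independent B" "card B = dim UNIV"
    using basis_exists by blast
  obtain C where "C \<subseteq> B" "card C = d"
    using obtain_subset_with_card_n[of d B] assms B by metis
  then show ?thesis
    using B independent_mono dim_span_eq_card_independent subspace_span by metis
qed

text \<open>The coefficient of \<open>x\<close> along \<open>y\<close> is non-zero, hence
  invertible. Consequently two lines sharing a non-zero vector coincide.\<close>

lemma (in vector_space) span_singleton_eqI:
  assumes "x \<in> span {y}" "x \<noteq> 0"
  shows "span {x} = span {y}"
proof -
  obtain c where c: "x = c *s y" using assms(1) by (auto simp: span_singleton)
  then have "y = inverse c *s x" using assms(2) by auto
  then have "y \<in> span {x}" by (auto simp: span_singleton)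
  then show ?thesis using assms(1) by (simp add: span_eq)
qed

lemma subspace_restrict_scalars:
  assumes "field_homomorphism e" "vector_space scale" "module.subspace scale S"
  shows "module.subspace (restrict_scalars e scale) S"
proof -
  interpret K: vector_space scale by fact
  interpret F: vector_space "restrict_scalars e scale"
    by (rule vector_space_restrict_scalars[OF assms(1,2)])
  show ?thesis
    using assms(3) unfolding K.subspace_def F.subspace_def by (simp add: restrict_scalars_def)
qed

text \<open>A line over \<open>'k\<close> has \<open>CARD('k)\<close> elements, which is the size of
  an \<open>m\<close>-dimensional space over \<open>'f\<close>. Disjointness away from 0 and
  uniqueness hold because a line is generated by any of its non-zero vectors.\<close>

lemma spread_line_spread:
  fixes e :: "'f::{field,finite} \<Rightarrow> 'k::{field,finite}"
    and scale :: "'k \<Rightarrow> 'v::ab_group_add \<Rightarrow> 'v"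
  assumes e: "field_homomorphism e" and V: "vector_space scale" and card: "CARD('k) = CARD('f) ^ m"
  shows "spread (restrict_scalars e scale) m (line_spread scale)"
proof -
  interpret K: vector_space scale by fact
  interpret F: vector_space "restrict_scalars e scale"
    by (rule vector_space_restrict_scalars[OF e V])
  have dim_line: "F.subspace (K.span {x}) \<and> F.dim (K.span {x}) = m" if "x \<noteq> 0" for x
    using subspace_restrict_scalars[OF e V K.subspace_span]
      K.finite_span_card_span[of "{x}"] that card
    by (auto intro: F.dim_eqI_card)
  have unique: "K.span {x} = K.span {y}"
    if "z \<in> K.span {x}" "z \<in> K.span {y}" "z \<noteq> 0" for x y z
    using that K.span_singleton_eqI by metis
  have "K.span {x} \<inter> K.span {y} = {0}" if "K.span {x} \<noteq> K.span {y}" for x y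
    using that unique[of _ x y] K.span_zero by blast
  with dim_line have "partial_spread (restrict_scalars e scale) m (line_spread scale)"
    unfolding partial_spread_def line_spread_def by blast
  moreover have "\<exists>!S. S \<in> line_spread scale \<and> x \<in> S" if "x \<noteq> 0" for x
  proof (rule ex1I[of _ "K.span {x}"])
    show "K.span {x} \<in> line_spread scale \<and> x \<in> K.span {x}"
      using that K.span_base by (auto simp: line_spread_def)
    show "S = K.span {x}" if "S \<in> line_spread scale \<and> x \<in> S" for S
      using that \<open>x \<noteq> 0\<close> K.span_singleton_eqI by (auto simp: line_spread_def)
  qed
  ultimately show ?thesis by (simp add: spread_def)
qed

text \<open>The identity is semilinear with the identity field automorphism, so any subfamily of
  lines is partial Desarguesian.\<close>

lemma desarguesian_line_spread:
  fixes e :: "'f::{field,finite} \<Rightarrow> 'k::{field,finite}"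
    and scale :: "'k \<Rightarrow> 'v::ab_group_add \<Rightarrow> 'v"
  assumes "field_homomorphism e" "vector_space scale" "CARD('k) = CARD('f) ^ m"
  shows "desarguesian_spread e scale m (line_spread scale)"
proof -
  have "semilinear_map (restrict_scalars e scale) id"
    unfolding semilinear_map_def field_homomorphism_def by (auto intro!: exI[of _ id])
  then show ?thesis
    using spread_line_spread[OF assms] unfolding desarguesian_spread_def
    by (auto intro!: exI[of _ id])
qed

theorem proposition3p2:
  fixes q m n h :: nat
    and e :: "'f::{field,finite} \<Rightarrow> 'k::{field,finite}"
    and scale :: "'k \<Rightarrow> 'v::ab_group_add \<Rightarrow> 'v"
  assumes "primepow q" and "m \<ge> 1" and "n \<ge> 2" and "1 \<le> h" and "h \<le> m"
    and "CARD('f) = q" and "CARD('k) = q ^ m" and "field_homomorphism e"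
    and "vector_space scale" and "vector_space.dim scale UNIV = n"
  shows "\<exists>A. partial_desarguesian_spread e scale m A \<and> card A = q ^ (m * (n - 1)) \<and>
           (\<exists>U. evasive (restrict_scalars e scale) A h U \<and>
                vector_space.dim (restrict_scalars e scale) U = m * (n - 1) + h)"
proof -
  note hom = assms(8)
  have CARD_k: "CARD('k) = CARD('f) ^ m" using assms by simp
  interpret K: vector_space scale by fact
  interpret F: vector_space "restrict_scalars e scale"
    by (rule vector_space_restrict_scalars[OF assms(8,9)])
  \<comment> \<open>View \<open>'k\<close> as a space over itself and restrict scalars along
    \<open>e\<close>; its dimension over \<open>'f\<close> is then \<open>m\<close>, and
    \<open>h \<le> m\<close> leaves room for \<open>W\<close>.\<close>
  have mult: "vector_space ((*) :: 'k \<Rightarrow> 'k \<Rightarrow> 'k)"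
    by unfold_locales (simp_all add: algebra_simps)
  interpret KF: vector_space "restrict_scalars e ((*) :: 'k \<Rightarrow> 'k \<Rightarrow> 'k)"
    by (rule vector_space_restrict_scalars[OF hom mult])
  have "KF.dim UNIV = m"
    by (rule KF.dim_eqI_card) (auto simp: CARD_k KF.subspace_UNIV)
  then obtain W where W: "KF.subspace W" "KF.dim W = h"
    using KF.subspace_of_dim_exists assms(5) by blast
  then have card_W: "card W = q ^ h"
    using KF.card_subspace assms(6) by simp
  have W_simps: "0 \<in> W" "\<And>a b. a \<in> W \<Longrightarrow> b \<in> W \<Longrightarrow> a + b \<in> W"
    "\<And>a b. b \<in> W \<Longrightarrow> e a * b \<in> W"
    using KF.subspace_0[OF W(1)] KF.subspace_add[OF W(1)] KF.subspace_scale[OF W(1)]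
    unfolding restrict_scalars_def by blast+

  obtain B where B: "K.independent B" "UNIV \<subseteq> K.span B" "card B = n"
    using K.basis_exists assms(10) by blast
  have finB: "finite B" using B(3) assms(3) by (intro card_ge_0_finite) simp
  \<comment> \<open>A finite basis over a finite field makes the whole space finite, so the counting
    lemmas apply to every subspace.\<close>
  have "finite (UNIV :: 'v set)"
    using K.finite_span_card_span[OF finite finB B(1)] B(2) by (simp add: top.extremum_unique)
  then have fin [simp]: "finite S" for S :: "'v set"
    by (rule finite_subset[OF subset_UNIV])
  obtain v where v: "v \<in> B" using B(3) assms(3) by fastforce
  define H where "H = K.span (B - {v})"
  have vH: "v \<notin> H" using B(1) v by (auto simp: H_def K.dependent_def)
  have H: "K.subspace H" by (simp add: H_def)
  have "K.independent (B - {v})" using B(1) K.independent_mono by blast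
  then have card_H: "card H = q ^ (m * (n - 1))"
    using K.finite_span_card_span[of "B - {v}"] finB v B(3) assms(7)
    by (simp add: H_def power_mult)
  have scale_v: "c = 0" if "scale c v \<in> H" for c
    using K.subspace_scale[OF H that, of "inverse c"] vH by (cases "c = 0") auto
  \<comment> \<open>The sum of the line through \<open>v\<close> and \<open>H\<close> is direct.
    This uniqueness of coordinates gives the sizes of \<open>A\<close> and \<open>U\<close> and
    controls the intersections of \<open>U\<close> with lines.\<close>
  have decomp: "c = d \<and> x = y"
    if "scale c v + x = scale d v + y" "x \<in> H" "y \<in> H" for c d x y
  proof -
    have "scale (c - d) v = y - x"
      using that(1) by (simp add: K.scale_left_diff_distrib algebra_simps)
    then have "c - d = 0"
      using scale_v K.subspace_diff[OF H that(3,2)] by metis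
    then show ?thesis using that(1) by simp
  qed

  define A where "A = (\<lambda>y. K.span {v + y}) ` H"
  have nz: "v + y \<noteq> 0" if "y \<in> H" for y
    using that vH K.subspace_neg[OF H that] by (metis add_eq_0_iff2)
  have "inj_on (\<lambda>y. K.span {v + y}) H"
  proof (rule inj_onI)
    fix x y assume xy: "x \<in> H" "y \<in> H" and "K.span {v + x} = K.span {v + y}"
    then have "v + x \<in> K.span {v + y}" using K.span_base by blast
    then obtain c where "v + x = scale c (v + y)" by (auto simp: K.span_singleton)
    \<comment> \<open>Writing \<open>v\<close> as \<open>scale 1 v\<close> lets
      \<open>decomp\<close> force \<open>c = 1\<close>: each line of \<open>A\<close> has only one
      vector with \<open>v\<close>-coordinate 1.\<close>
    then have "scale 1 v + x = scale c v + scale c y" by (simp add: K.scale_right_distrib)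
    then have "1 = c \<and> x = scale c y"
      using decomp xy K.subspace_scale[OF H] by blast
    then show "x = y" by auto
  qed
  then have card_A: "card A = q ^ (m * (n - 1))"
    by (simp add: A_def card_image card_H)
  have A_lines: "A \<subseteq> line_spread scale"
    using nz by (auto simp: A_def line_spread_def)
  \<comment> \<open>The conditions concern single members and pairs of members, so they pass to
    subfamilies.\<close>
  moreover have "partial_spread (restrict_scalars e scale) m A"
    using A_lines spread_line_spread[OF hom assms(9) CARD_k]
    unfolding spread_def partial_spread_def by (meson subsetD)
  ultimately have A: "partial_desarguesian_spread e scale m A"
    using desarguesian_line_spread[OF hom assms(9) CARD_k]
    unfolding partial_desarguesian_spread_def by blast

  define U where "U = (\<lambda>(c, y). scale c v + y) ` (W \<times> H)"
  have U: "F.subspace U"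
  proof (rule F.subspaceI)
    show "0 \<in> U"
      using W_simps(1) K.subspace_0[OF H] unfolding U_def
      by (intro image_eqI[of _ _ "(0, 0)"]) auto
  next
    fix x y assume "x \<in> U" "y \<in> U"
    then obtain c d x' y' where "x = scale c v + x'" "y = scale d v + y'"
      "c \<in> W" "d \<in> W" "x' \<in> H" "y' \<in> H" by (auto simp: U_def)
    then show "x + y \<in> U"
      using W_simps(2) K.subspace_add[OF H] unfolding U_def
      by (intro image_eqI[of _ _ "(c + d, x' + y')"]) (auto simp: K.scale_left_distrib)
  next
    fix a x assume "x \<in> U"
    then obtain c x' where "x = scale c v + x'" "c \<in> W" "x' \<in> H" by (auto simp: U_def)
    \<comment> \<open>Scaling by \<open>e a\<close> keeps the \<open>v\<close>-coordinate in
      \<open>W\<close>, which is closed under multiplication by the image of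
      \<open>e\<close>.\<close>
    then show "restrict_scalars e scale a x \<in> U"
      using W_simps(3) K.subspace_scale[OF H] unfolding U_def
      by (intro image_eqI[of _ _ "(e a * c, scale (e a) x')"])
         (auto simp: K.scale_right_distrib restrict_scalars_def)
  qed
  have "inj_on (\<lambda>(c, y). scale c v + y) (W \<times> H)"
    by (rule inj_onI) (use decomp in auto)
  then have "card U = CARD('f) ^ (m * (n - 1) + h)"
    by (simp add: U_def card_image card_W card_H card_cartesian_product power_add assms(6))
  then have dim_U: "F.dim U = m * (n - 1) + h"
    using U by (intro F.dim_eqI_card) auto
  have "F.dim (U \<inter> S) \<le> h" if "S \<in> A" for S
  proof -
    obtain y where y: "y \<in> H" "S = K.span {v + y}" using \<open>S \<in> A\<close> by (auto simp: A_def)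
    \<comment> \<open>A vector \<open>scale c (v + y)\<close> has \<open>v\<close>-coordinate
      \<open>c\<close>, and membership in \<open>U\<close> puts this coordinate in \<open>W\<close>.
      One inclusion suffices for the upper bound \<open>q ^ h\<close> on the size.\<close>
    have "U \<inter> S \<subseteq> (\<lambda>c. scale c (v + y)) ` W"
    proof
      fix z assume z: "z \<in> U \<inter> S"
      obtain c where c: "z = scale c (v + y)" using z y by (auto simp: K.span_singleton)
      obtain d x where "d \<in> W" "x \<in> H" "z = scale d v + x" using z by (auto simp: U_def)
      moreover from this have "scale d v + x = scale c v + scale c y"
        using c K.scale_right_distrib by metis
      ultimately have "c \<in> W"
        using decomp K.subspace_scale[OF H y(1)] by metis
      then show "z \<in> (\<lambda>c. scale c (v + y)) ` W" using c by blast
    qed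
    then have "card (U \<inter> S) \<le> CARD('f) ^ h"
      using card_W assms(6) by (metis finite surj_card_le)
    moreover have "F.subspace (U \<inter> S)"
      using U y(2) subspace_restrict_scalars[OF hom assms(9) K.subspace_span]
      by (simp add: F.subspace_inter)
    \<comment> \<open>The intersection is a subspace over \<open>'f\<close>, so its size is a power
      of \<open>q\<close>; since \<open>q > 1\<close>, the exponents compare likewise.\<close>
    ultimately have "q ^ F.dim (U \<inter> S) \<le> q ^ h"
      using F.card_subspace[of "U \<inter> S"] assms(6) by simp
    then show ?thesis
      using primepow_gt_Suc_0[OF assms(1)] power_increasing_iff[of q] by simp
  qed
  then have "evasive (restrict_scalars e scale) A h U"
    using U by (simp add: evasive_def)
  with A card_A dim_U show ?thesis by blast
qed

end
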